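(* For the torus of size $n\ge 3$, the normalizing factor satisfies $Z>\left(4(\ln n+1)\right)^{-1}$.
   Context: Let $n\ge 3$, $[\![n]\!]=\{0,1,\dots,n-1\}$, and let $T$ be the two-dimensional undirected torus with vertex set $V=[\![n]\!]^2$, where $(i,j)$ is adjacent to $(i,(j+1)\bmod n)$ and $((i+1)\bmod n,j)$. For $u=(x_u,y_u),v=(x_v,y_v)\in V$, $d_{uv}=\min(|x_u-x_v|,n-|x_u-x_v|)+\min(|y_u-y_v|,n-|y_u-y_v|)$. The normalizing factor is $Z=\left(\sum_{v\in V\setminus\{u\}} d_{uv}^{-2}\right)^{-1}$ for any $u\in V$ (its value does not depend on $u$). $\ln$ denotes the natural logarithm. *)

theory Defs
  imports Complex_Main
begin

(* Vertices have integer coordinates, so that the differences below are not truncated. *)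
definition torus_verts :: "nat \<Rightarrow> (int \<times> int) set" where
  "torus_verts n = {0..<int n} \<times> {0..<int n}"

definition torus_dist :: "nat \<Rightarrow> int \<times> int \<Rightarrow> int \<times> int \<Rightarrow> int" where
  "torus_dist n u v =
     min \<bar>fst u - fst v\<bar> (int n - \<bar>fst u - fst v\<bar>) +
     min \<bar>snd u - snd v\<bar> (int n - \<bar>snd u - snd v\<bar>)"

(* The base vertex u is kept as a parameter; for u in torus_verts n the value
   does not depend on it. *)
definition norm_factor :: "nat \<Rightarrow> int \<times> int \<Rightarrow> real" where
  "norm_factor n u =
     inverse (\<Sum>v \<in> torus_verts n - {u}. real_of_int (torus_dist n u v) powi (-2))"

end

theory Submission
  imports Defs
begin

text \<open>
  Every vertex at torus distance \<open>k\<close> from \<open>u\<close> has a signed displacement \<open>(a, b)\<close> in the integer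
  lattice with \<open>\<bar>a\<bar> + \<bar>b\<bar> = k\<close>, so there are at most \<open>4 k\<close> of them. No distance exceeds
  \<open>2 \<lfloor>n / 2\<rfloor> \<le> n\<close>, so the sum of the \<open>d\<^sup>-\<^sup>2\<close> is at most four times the \<open>n\<close>-th harmonic
  number, which is less than \<open>ln n + 1\<close>.
\<close>

text \<open>Telescoping: \<open>ln t < t - 1\<close> at t = k / (k + 1) bounds 1 / (k + 1) strictly
  by ln (k + 1) - ln k. For n = 1 both sides equal 1, so the induction starts at 2.\<close>

lemma sum_inverse_less_ln:
  assumes "n \<ge> 2"
  shows "(\<Sum>k=1..n. 1 / real k) < ln (real n) + 1"
proof -
  have increment: "1 / real (Suc k) < ln (real (Suc k)) - ln (real k)" if "k \<ge> 1" for k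
  proof -
    have "ln (real k / real (Suc k)) < real k / real (Suc k) - 1"
      using that by (smt (verit) ln_eq_minus_one ln_le_minus_one divide_pos_pos of_nat_0_less_iff
          divide_eq_1_iff of_nat_eq_iff n_not_Suc_n zero_less_Suc less_le_trans zero_less_one)
    moreover have "real k / real (Suc k) - 1 = - (1 / real (Suc k))"
      by (simp add: field_simps)
    ultimately show ?thesis
      using that by (simp add: ln_div)
  qed
  show ?thesis
    using assms
  proof (induction n rule: dec_induct)
    case base
    show ?case
      using increment[of 1] by (simp add: numeral_2_eq_2)
  next
    case (step m)
    then show ?case
      using increment[of m] by simp
  qed
qed

lemma card_lattice_sphere_le:
  "finite {p :: int \<times> int. \<bar>fst p\<bar> + \<bar>snd p\<bar> = int k}"
  "k \<ge> 1 \<Longrightarrow> card {p :: int \<times> int. \<bar>fst p\<bar> + \<bar>snd p\<bar> = int k} \<le> 4 * k"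
proof -
  let ?S = "{p :: int \<times> int. \<bar>fst p\<bar> + \<bar>snd p\<bar> = int k}"
  have "?S \<subseteq> {- int k..int k} \<times> {- int k..int k}"
    by auto
  then show "finite ?S"
    by (rule finite_subset) simp
  assume "k \<ge> 1"
  define I where "I = {0..<int k}"
  \<comment> \<open>The sphere is a diamond. \<open>f j\<close> runs counterclockwise along one of
    its sides from the corner (k, 0), (0, k), (-k, 0) or (0, -k), leaving out the end corner, which
    starts the next side. So each side has k points.\<close>
  define f :: "nat \<Rightarrow> int \<Rightarrow> int \<times> int" where
    "f = (\<lambda>j i. if j = 0 then (int k - i, i) else if j = 1 then (- i, int k - i)
                else if j = 2 then (i - int k, - i) else (i, i - int k))"
  have "?S \<subseteq> (\<Union>j<4. f j ` I)"
  proof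
    fix p assume "p \<in> ?S"
    then obtain a b where p: "p = (a, b)" and ab: "\<bar>a\<bar> + \<bar>b\<bar> = int k"
      by (cases p) auto
    \<comment> \<open>These half-open quadrants match the four sides and cover everything but the
      origin, which k >= 1 rules out.\<close>
    consider "a > 0" "b \<ge> 0" | "a \<le> 0" "b > 0" | "a < 0" "b \<le> 0" | "a \<ge> 0" "b < 0"
      using ab \<open>k \<ge> 1\<close> by linarith
    then have "\<exists>j<4. \<exists>i\<in>I. p = f j i"
    proof cases
      case 1
      then show ?thesis
        using ab p by (intro exI[of _ 0] conjI bexI[of _ b]) (auto simp: f_def I_def)
    next
      case 2
      then show ?thesis
        using ab p by (intro exI[of _ 1] conjI bexI[of _ "- a"]) (auto simp: f_def I_def)
    next
      case 3
      then show ?thesis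
        using ab p by (intro exI[of _ 2] conjI bexI[of _ "- b"]) (auto simp: f_def I_def)
    next
      case 4
      then show ?thesis
        using ab p by (intro exI[of _ 3] conjI bexI[of _ a]) (auto simp: f_def I_def)
    qed
    then show "p \<in> (\<Union>j<4. f j ` I)"
      by auto
  qed
  then have "card ?S \<le> card (\<Union>j<4. f j ` I)"
    by (intro card_mono) (auto simp: I_def)
  also have "\<dots> \<le> (\<Sum>j<4. card (f j ` I))"
    by (rule card_UN_le) simp
  also have "\<dots> \<le> (\<Sum>j<(4::nat). k)"
    by (intro sum_mono order_trans[OF card_image_le]) (auto simp: I_def)
  finally show "card ?S \<le> 4 * k"
    by simp
qed

text \<open>For coordinates in range, this is the representative of x - a modulo n of least absolute
  value; a tie is settled in favour of x - a itself.\<close>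

definition cyclic_displacement :: "nat \<Rightarrow> int \<Rightarrow> int \<Rightarrow> int" where
  "cyclic_displacement n a x =
     (if \<bar>a - x\<bar> \<le> int n - \<bar>a - x\<bar> then x - a else if x > a then x - a - int n else x - a + int n)"

lemma abs_cyclic_displacement:
  assumes "a \<in> {0..<int n}" "x \<in> {0..<int n}"
  shows "\<bar>cyclic_displacement n a x\<bar> = min \<bar>a - x\<bar> (int n - \<bar>a - x\<bar>)"
  using assms by (auto simp: cyclic_displacement_def)

text \<open>The displacement is congruent to x - a modulo n, and the residue of x determines x
  within {0..<n}.\<close>

lemma inj_on_cyclic_displacement:
  assumes "a \<in> {0..<int n}"
  shows "inj_on (cyclic_displacement n a) {0..<int n}"
  using assms by (intro inj_onI) (auto simp: cyclic_displacement_def split: if_splits)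

lemma finite_torus_verts: "finite (torus_verts n)"
  by (simp add: torus_verts_def)

lemma torus_dist_bounds:
  assumes "u \<in> torus_verts n" "v \<in> torus_verts n - {u}"
  shows "1 \<le> torus_dist n u v" "torus_dist n u v \<le> int n"
proof -
  have "fst u \<noteq> fst v \<or> snd u \<noteq> snd v"
    using assms by (auto simp: prod_eq_iff)
  then show "1 \<le> torus_dist n u v"
    using assms unfolding torus_dist_def torus_verts_def by (cases u; cases v) auto
  show "torus_dist n u v \<le> int n"
    unfolding torus_dist_def by linarith
qed

text \<open>Taking displacements in both coordinates embeds the torus sphere into the lattice sphere
  of the same radius.\<close>

lemma card_torus_sphere_le:
  assumes u: "u \<in> torus_verts n" and "k \<ge> 1"
  shows "card {v \<in> torus_verts n. torus_dist n u v = int k} \<le> 4 * k"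
proof -
  let ?A = "{v \<in> torus_verts n. torus_dist n u v = int k}"
  define f where
    "f = map_prod (cyclic_displacement n (fst u)) (cyclic_displacement n (snd u))"
  have "inj_on f (torus_verts n)"
    using u unfolding f_def torus_verts_def
    by (intro map_prod_inj_on inj_on_cyclic_displacement) auto
  then have "inj_on f ?A"
    by (rule inj_on_subset) auto
  moreover have "f ` ?A \<subseteq> {p. \<bar>fst p\<bar> + \<bar>snd p\<bar> = int k}"
    using u by (auto simp: f_def torus_verts_def torus_dist_def abs_cyclic_displacement)
  ultimately have "card ?A \<le> card {p :: int \<times> int. \<bar>fst p\<bar> + \<bar>snd p\<bar> = int k}"
    by (rule card_inj_on_le) (rule card_lattice_sphere_le)
  also have "\<dots> \<le> 4 * k"
    using \<open>k \<ge> 1\<close> by (rule card_lattice_sphere_le)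
  finally show ?thesis .
qed

lemma sum_torus_dist_le:
  assumes u: "u \<in> torus_verts n"
  shows "(\<Sum>v\<in>torus_verts n - {u}. real_of_int (torus_dist n u v) powi (-2))
           \<le> 4 * (\<Sum>k=1..n. 1 / real k)"
proof -
  let ?V = "torus_verts n - {u}"
  let ?d = "\<lambda>v. nat (torus_dist n u v)"
  have "(\<Sum>v\<in>?V. real_of_int (torus_dist n u v) powi (-2))
      = (\<Sum>k=1..n. \<Sum>v | v \<in> ?V \<and> ?d v = k. real_of_int (torus_dist n u v) powi (-2))"
    \<comment> \<open>Every distance lies in {1..n}, so grouping by distance loses no
      vertex.\<close>
    using torus_dist_bounds[OF u]
    by (intro sum.group[symmetric]) (force simp: finite_torus_verts)+
  also have "\<dots> \<le> (\<Sum>k=1..n. 4 * (1 / real k))"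
  proof (rule sum_mono)
    fix k assume "k \<in> {1..n}"
    then have k: "k \<ge> 1"
      by simp
    let ?A = "{v. v \<in> ?V \<and> ?d v = k}"
    \<comment> \<open>As k >= 1, the truncation in \<open>nat\<close> is harmless:
      \<open>?d v = k\<close> forces the integer distance to be k.\<close>
    have "card ?A \<le> card {v \<in> torus_verts n. torus_dist n u v = int k}"
      using k by (intro card_mono) (auto simp: finite_torus_verts)
    then have card: "card ?A \<le> 4 * k"
      using card_torus_sphere_le[OF u k] by linarith
    have "(\<Sum>v\<in>?A. real_of_int (torus_dist n u v) powi (-2)) = (\<Sum>v\<in>?A. real k powi (-2))"
      using k by (intro sum.cong) auto
    also have "\<dots> = real (card ?A) * real k powi (-2)"
      by simp
    also have "\<dots> \<le> real (4 * k) * real k powi (-2)"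
      using card by (intro mult_right_mono) (simp_all only: of_nat_le_iff zero_le_power_int of_nat_0_le_iff)
    also have "\<dots> = 4 * (1 / real k)"
      using k by (simp add: power_int_minus field_simps power2_eq_square)
    finally show "(\<Sum>v\<in>?A. real_of_int (torus_dist n u v) powi (-2)) \<le> 4 * (1 / real k)" .
  qed
  finally show ?thesis
    by (simp add: sum_distrib_left)
qed

theorem theorem7:
  fixes n :: nat and u :: "int \<times> int"
  assumes "n \<ge> 3" and "u \<in> torus_verts n"
  shows "norm_factor n u > inverse (4 * (ln (real n) + 1))"
proof -
  let ?S = "\<Sum>v\<in>torus_verts n - {u}. real_of_int (torus_dist n u v) powi (-2)"
  \<comment> \<open>Of two distinct vertices one survives the removal of \<open>u\<close>. This
    makes the sum positive, as is needed for \<open>inverse\<close> to reverse the inequality, since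
    \<open>inverse 0 = 0\<close>.\<close>
  have "(0, 0) \<in> torus_verts n" "(0, 1) \<in> torus_verts n"
    using assms(1) by (auto simp: torus_verts_def)
  then have "torus_verts n - {u} \<noteq> {}"
    by (cases "u = (0, 0)") auto
  then have "?S > 0"
    using torus_dist_bounds(1)[OF assms(2)]
    by (intro sum_pos zero_less_power_int) (force simp: finite_torus_verts)+
  moreover have "?S < 4 * (ln (real n) + 1)"
    using sum_torus_dist_le[OF assms(2)] sum_inverse_less_ln[of n] assms(1) by simp
  ultimately show ?thesis
    unfolding norm_factor_def by (intro less_imp_inverse_less)
qed

end
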